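(* Let $n\in\mathbb{N}_0$, $f\in\mathcal{M}_{0,n}^{-1}(L_c)$ and $c_0<1-n$. Then $f(x)$, $x\in\mathbb{R}_+$, is $n$ times continuously differentiable, $(Ff^{(n)})(z)$ is analytic in the half-plane $\operatorname{Re} z>c_0+n-1$ and $(Ff^{(n)})(z)=(Ff)(z-n)$. Finally, for any arbitrary $y\in\mathbb{R}_+$ the following representation holds: $$(Ff)_y(z)=2\int_y^\infty x^{z/2}K_z(2\sqrt{x})f(x)\,dx=2\sum_{m=0}^{n-1}(-1)^m y^{(z+m+1)/2}K_{z+m+1}(2\sqrt{y})\,f^{(m)}(y)+(-1)^n\left(Ff^{(n)}\right)_y(z+n),\quad y>0,$$ where the empty sum ($n=0$) is equal to zero.
   Context: $K_z$ is the modified Bessel function of complex order $z$, with $K_z(2\sqrt{x})=\frac{x^{-z/2}}{2}\int_0^\infty e^{-t-x/t}t^{z-1}\,dt$ for $x>0$. The transformation $F$ is $(Ff)(z)=2\int_0^\infty x^{z/2}K_z(2\sqrt{x})f(x)\,dx$, and for $y>0$ its truncated version is $(Ff)_y(z)=2\int_y^\infty x^{z/2}K_z(2\sqrt{x})f(x)\,dx$; $(Ff^{(n)})_y$ is the same truncated integral with $f$ replaced by its $n$-th derivative $f^{(n)}$. For $c_0\in\mathbb{R}$ let $c=\{s\in\mathbb{C}:\operatorname{Re} s=c_0\}$, and let $L_1(c)$ be the space of integrable functions on this vertical line. For real $c_1,c_2$ with $2\operatorname{sign}c_1+\operatorname{sign}c_2\ge0$, $\mathcal{M}_{c_1,c_2}^{-1}(L_c)$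 denotes the space of functions $f(x)$, $x\in\mathbb{R}_+=(0,\infty)$, representable in the form $f(x)=\frac{1}{2\pi i}\int_c f^*(s)x^{-s}\,ds$, where $s^{c_2}e^{\pi c_1|s|}f^*(s)\in L_1(c)$. Thus $f\in\mathcal{M}_{0,n}^{-1}(L_c)$ means that $f$ has this form with $s^nf^*(s)\in L_1(c)$.
   Formalization: The factors (-1)^m and (-1)^n in the formula for (Ff)_y(z) are removed: integration by parts gives no alternating signs, and the printed formula fails for n=1, e.g. for f(x)=x^3 e^{-x}, c_0=-1, real z and y>3. *)

theory Defs
  imports "HOL-Analysis.Analysis"
begin

text \<open>
  The modified Bessel function of complex order \<open>z\<close> at real arguments \<open>w > 0\<close>, normalised by the
  integral representation with \<open>x = (w/2)\<^sup>2\<close>, so that \<open>w = 2 \<surd>x\<close> (see \<open>bessel_K_two_sqrt\<close>).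
\<close>

definition bessel_K :: "complex \<Rightarrow> real \<Rightarrow> complex" where
  "bessel_K z w = (let x = (w / 2)\<^sup>2 in
     of_real x powr (- z / 2) / 2 *
       (LBINT t:{0<..}. of_real (exp (- t - x / t)) * of_real t powr (z - 1)))"

lemma bessel_K_two_sqrt:
  assumes "x > 0"
  shows "bessel_K z (2 * sqrt x) =
    of_real x powr (- z / 2) / 2 *
      (LBINT t:{0<..}. of_real (exp (- t - x / t)) * of_real t powr (z - 1))"
  using assms by (simp add: bessel_K_def)

definition F_integrand :: "(real \<Rightarrow> complex) \<Rightarrow> complex \<Rightarrow> real \<Rightarrow> complex" where
  "F_integrand f z x = of_real x powr (z / 2) * bessel_K z (2 * sqrt x) * f x"

definition F_transform :: "(real \<Rightarrow> complex) \<Rightarrow> complex \<Rightarrow> complex" where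
  "F_transform f z = 2 * (LBINT x:{0<..}. F_integrand f z x)"

definition F_truncated :: "real \<Rightarrow> (real \<Rightarrow> complex) \<Rightarrow> complex \<Rightarrow> complex" where
  "F_truncated y f z = 2 * (LBINT x:{y..}. F_integrand f z x)"

text \<open>The vertical line \<open>Re s = c\<^sub>0\<close> is parametrised by \<open>s = c\<^sub>0 + i t\<close>, hence \<open>ds = i dt\<close>.\<close>

definition L1_line :: "real \<Rightarrow> (complex \<Rightarrow> complex) \<Rightarrow> bool" where
  "L1_line c0 g \<longleftrightarrow> integrable lborel (\<lambda>t. g (Complex c0 t))"

definition line_integral :: "real \<Rightarrow> (complex \<Rightarrow> complex) \<Rightarrow> complex" where
  "line_integral c0 g = (LBINT t. g (Complex c0 t) * \<i>)"

text \<open>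
  Elements of the space are functions on \<open>{0<..}\<close>; their values elsewhere are unconstrained.
  Since \<open>\<bar>x powr (-s)\<bar>\<close> is constant on the line, the inversion integral converges absolutely for
  one \<open>x > 0\<close> iff it does for all of them. The weight condition implies this convergence unless
  \<open>c0 = 0\<close>; if it fails there, the integral is \<open>0\<close> by convention, and the zero function belongs
  to the space anyway (take \<open>fs = 0\<close>).
\<close>

definition inverse_Mellin_space :: "real \<Rightarrow> real \<Rightarrow> real \<Rightarrow> (real \<Rightarrow> complex) set" where
  "inverse_Mellin_space c1 c2 c0 = {f. 2 * sgn c1 + sgn c2 \<ge> 0 \<and>
     (\<exists>fs :: complex \<Rightarrow> complex.
        L1_line c0 (\<lambda>s. s powr of_real c2 * of_real (exp (pi * c1 * norm s)) * fs s) \<and>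
        (\<forall>x>0. f x = 1 / (2 * of_real pi * \<i>) *
           line_integral c0 (\<lambda>s. fs s * of_real x powr (- s))))}"

definition nth_vderiv :: "nat \<Rightarrow> (real \<Rightarrow> complex) \<Rightarrow> real \<Rightarrow> complex" where
  "nth_vderiv n f = ((\<lambda>g x. vector_derivative g (at x)) ^^ n) f"

text \<open>\<open>S\<close> is meant to be open.\<close>

definition n_times_cont_differentiable_on :: "nat \<Rightarrow> (real \<Rightarrow> complex) \<Rightarrow> real set \<Rightarrow> bool" where
  "n_times_cont_differentiable_on n f S \<longleftrightarrow>
     (\<forall>k<n. \<forall>x\<in>S. nth_vderiv k f differentiable (at x)) \<and> continuous_on S (nth_vderiv n f)"

text \<open>
  Signs in the formula for the truncated transform. Put
  \<open>\<rho> z x = 2 x\<^bsup>z/2\<^esup> K\<^sub>z(2 \<surd>x) = \<integral>\<^sub>0\<^sup>\<infinity> exp (- t - x/t) t\<^bsup>z-1\<^esup> dt\<close>. Differentiating in \<open>x\<close> gives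
  \<open>\<rho> (z+1)' = - \<rho> z\<close>, and one integration by parts yields
  \<open>\<integral>\<^sub>y\<^sup>\<infinity> \<rho> z f = \<rho> (z+1) y f(y) + \<integral>\<^sub>y\<^sup>\<infinity> \<rho> (z+1) f'\<close>:
  the two minus signs cancel, so iterating produces no alternating factors. The factors
  \<open>(-1)\<^sup>m\<close> and \<open>(-1)\<^sup>n\<close> printed in the source are a sign slip (with them the formula fails already
  for \<open>n = 1\<close>, and for \<open>y \<rightarrow> 0\<close> and odd \<open>n\<close> it contradicts \<open>(F f\<^bsup>(n)\<^esup>)(z) = (F f)(z - n)\<close>);
  they are omitted.
\<close>

end

theory Submission
  imports Defs "HOL-Complex_Analysis.Complex_Analysis"
begin

text \<open>
  Write \<open>\<rho> z x = 2 x\<^bsup>z/2\<^esup> K\<^sub>z(2 \<surd>x)\<close>, so that \<open>(F f)(z)\<close> is the integral of \<open>\<rho> z f\<close>. Three properties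
  of this kernel carry the proof. First, for every \<open>e > 0\<close> with \<open>Re z + e > 0\<close> it is bounded by a
  constant times \<open>x\<^bsup>-e\<^esup>\<close> (\<open>rho_major_bound\<close>); choosing \<open>e\<close> small near \<open>0\<close> and large near infinity makes
  \<open>\<rho> z g\<close> integrable on \<open>(0, \<infinity>)\<close> for every continuous \<open>g\<close> of size \<open>x\<^bsup>-c\<^esup>\<close> with \<open>c < 1\<close> and
  \<open>Re z > c - 1\<close>, and on \<open>[y, \<infinity>)\<close> for every \<open>z\<close> and \<open>c\<close>. Secondly, \<open>\<rho> (z + 1)\<close> has the derivative
  \<open>- \<rho> z\<close> in \<open>x\<close> (\<open>rho_has_vector_derivative\<close>). Thirdly, the derivative of \<open>\<rho>\<close> in \<open>z\<close> obeys bounds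
  of the same kind at slightly shifted orders, so the transform of \<open>g\<close> may be differentiated under
  the integral sign and is holomorphic (\<open>rho_transform_holomorphic\<close>).

  On the other side, differentiating the Mellin inversion integral of \<open>f\<close> under the integral sign
  gives \<open>f\<^bsup>(k)\<^esup>\<close> for \<open>k \<le> n\<close> as an inversion integral with the extra factor
  \<open>(-1)\<^sup>k s (s + 1) \<dots> (s + k - 1)\<close>, which the weight \<open>s\<^sup>n\<close> keeps integrable; hence \<open>f\<^bsup>(k)\<^esup>\<close> is of size
  \<open>x\<^bsup>-c0-k\<^esup>\<close>.

  Integrating \<open>\<rho> z f\<^bsup>(k)\<^esup>\<close> by parts (\<open>rho_integration_by_parts\<close>) moves a derivative onto \<open>f\<close> and raises
  the order by \<open>1\<close>. On \<open>[y, \<infinity>)\<close> the boundary terms at \<open>y\<close> accumulate to the finite sum of the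
  truncated formula. On \<open>(0, \<infinity>)\<close> they vanish, as \<open>\<rho> (z + 1) f\<^bsup>(k)\<^esup>\<close> tends to \<open>0\<close> at \<open>0\<close> when
  \<open>c0 + k < 0\<close> and \<open>Re z + 1 > c0 + k\<close>; this gives \<open>(F f\<^bsup>(n)\<^esup>)(z) = (F f)(z - n)\<close>.
\<close>

section \<open>Dominated differentiation of parameter integrals\<close>

text \<open>
  The scalar map \<open>J\<close> lets one statement serve both a real parameter (\<open>J = of_real\<close>, derivatives in
  \<open>x\<close>) and a complex one (\<open>J = id\<close>, derivatives in \<open>z\<close>). A bound on \<open>D\<close> over a ball is a Lipschitz
  bound there by the mean value inequality, so the difference quotients, corrected by their limit,
  are dominated by \<open>2 w\<close>.
\<close>

lemma has_derivative_integral_dominated: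
  fixes f :: "'u :: real_normed_vector \<Rightarrow> 'm \<Rightarrow> complex" and J :: "'u \<Rightarrow> complex"
  assumes "\<delta> > 0"
    and J: "bounded_linear J" "\<And>h. norm (J h) = norm h"
    and int: "\<And>u. u \<in> ball u0 \<delta> \<Longrightarrow> integrable M (f u)"
    and D_meas [measurable]: "D u0 \<in> borel_measurable M"
    and der: "\<And>u t. \<lbrakk>u \<in> ball u0 \<delta>; t \<in> space M\<rbrakk> \<Longrightarrow>
      ((\<lambda>u. f u t) has_derivative (\<lambda>h. J h * D u t)) (at u)"
    and w: "integrable M w"
    and bound: "\<And>u t. \<lbrakk>u \<in> ball u0 \<delta>; t \<in> space M\<rbrakk> \<Longrightarrow> norm (D u t) \<le> w t"
  shows "((\<lambda>u. LINT t|M. f u t) has_derivative (\<lambda>h. J h * (LINT t|M. D u0 t))) (at u0)"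
proof -
  have D_int: "integrable M (D u0)"
  proof (rule Bochner_Integration.integrable_bound[OF w])
    show "AE t in M. norm (D u0 t) \<le> norm (w t)"
      using bound[of u0] \<open>\<delta> > 0\<close> by (intro AE_I2) (auto intro: order_trans[OF _ abs_ge_self])
  qed measurable
  have lip: "norm (f u t - f u0 t) \<le> w t * norm (u - u0)"
    if "u \<in> ball u0 \<delta>" "t \<in> space M" for u t
  proof (rule differentiable_bound[where f' = "\<lambda>u h. J h * D u t" and S = "ball u0 \<delta>"])
    show "convex (ball u0 \<delta>)" by (rule convex_ball)
  next
    fix v assume v: "v \<in> ball u0 \<delta>"
    show "((\<lambda>u. f u t) has_derivative (\<lambda>h. J h * D v t)) (at v within ball u0 \<delta>)"
      using der[OF v \<open>t \<in> space M\<close>] by (rule has_derivative_at_withinI)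
    show "onorm (\<lambda>h. J h * D v t) \<le> w t"
    proof (rule onorm_bound)
      show "0 \<le> w t" using bound[OF v \<open>t \<in> space M\<close>] norm_ge_zero order_trans by blast
    next
      fix h
      show "norm (J h * D v t) \<le> w t * norm h"
        using mult_left_mono[OF bound[OF v \<open>t \<in> space M\<close>] norm_ge_zero[of h]]
        by (simp add: norm_mult J(2) mult.commute)
    qed
  qed (use that \<open>\<delta> > 0\<close> in auto)
  have "((\<lambda>u. ((LINT t|M. f u t) - (LINT t|M. f u0 t) - J (u - u0) * (LINT t|M. D u0 t))
             /\<^sub>R norm (u - u0)) \<longlongrightarrow> 0) (at u0)"
    unfolding tendsto_at_iff_sequentially o_def
  proof (intro allI impI)
    fix X :: "nat \<Rightarrow> 'u"
    assume X_ne: "\<forall>i. X i \<in> UNIV - {u0}" and X_lim: "X \<longlonglongrightarrow> u0"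
    define q where "q u t = (f u t - f u0 t - J (u - u0) * D u0 t) /\<^sub>R norm (u - u0)" for u t
    obtain N where N: "\<And>i. i \<ge> N \<Longrightarrow> X i \<in> ball u0 \<delta>"
      using X_lim \<open>\<delta> > 0\<close> unfolding lim_sequentially by (metis dist_commute mem_ball)
    define Y where "Y i = X (i + N)" for i
    have Y_in: "Y i \<in> ball u0 \<delta>" for i unfolding Y_def by (rule N) simp
    have Y_ne: "Y i \<noteq> u0" for i using X_ne unfolding Y_def by simp
    have Y_lim: "Y \<longlonglongrightarrow> u0"
      unfolding Y_def using X_lim by (rule LIMSEQ_ignore_initial_segment)
    have eq: "((LINT t|M. f (Y i) t) - (LINT t|M. f u0 t) - J (Y i - u0) * (LINT t|M. D u0 t))
               /\<^sub>R norm (Y i - u0) = (LINT t|M. q (Y i) t)" for i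
      unfolding q_def using int[OF Y_in[of i]] int[of u0] D_int \<open>\<delta> > 0\<close> by simp
    have q_meas: "(\<lambda>t. q (Y i) t) \<in> borel_measurable M" for i
      unfolding q_def using int[OF Y_in[of i]] int[of u0] D_int \<open>\<delta> > 0\<close> by simp
    have "(\<lambda>i. LINT t|M. q (Y i) t) \<longlonglongrightarrow> (LINT t|M. 0)"
    proof (rule integral_dominated_convergence[where w = "\<lambda>t. 2 * w t"])
      show "AE t in M. (\<lambda>i. q (Y i) t) \<longlonglongrightarrow> 0"
      proof (rule AE_I2)
        fix t assume t: "t \<in> space M"
        have "((\<lambda>u. (f u t - f u0 t - J (u - u0) * D u0 t) /\<^sub>R norm (u - u0)) \<longlongrightarrow> 0) (at u0)"
          using der[of u0 t] t \<open>\<delta> > 0\<close> unfolding has_derivative_at_within by simp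
        thus "(\<lambda>i. q (Y i) t) \<longlonglongrightarrow> 0"
          unfolding tendsto_at_iff_sequentially o_def q_def using Y_lim Y_ne by blast
      qed
      show "AE t in M. norm (q (Y i) t) \<le> 2 * w t" for i
      proof (rule AE_I2)
        fix t assume t: "t \<in> space M"
        have "norm (f (Y i) t - f u0 t - J (Y i - u0) * D u0 t)
            \<le> norm (f (Y i) t - f u0 t) + norm (J (Y i - u0) * D u0 t)"
          by (rule norm_triangle_ineq4)
        also have "\<dots> \<le> w t * norm (Y i - u0) + w t * norm (Y i - u0)"
          using lip[OF Y_in t, of i] bound[of u0 t] t \<open>\<delta> > 0\<close>
          by (intro add_mono) (auto simp: norm_mult J(2) mult.commute intro: mult_right_mono)
        finally show "norm (q (Y i) t) \<le> 2 * w t"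
          unfolding q_def using Y_ne[of i] by (simp add: divide_simps mult_ac)
      qed
    qed (use w q_meas in auto)
    hence "(\<lambda>i. ((LINT t|M. f (Y i) t) - (LINT t|M. f u0 t) - J (Y i - u0) * (LINT t|M. D u0 t))
               /\<^sub>R norm (Y i - u0)) \<longlonglongrightarrow> 0"
      unfolding eq by simp
    thus "(\<lambda>i. ((LINT t|M. f (X i) t) - (LINT t|M. f u0 t) - J (X i - u0) * (LINT t|M. D u0 t))
               /\<^sub>R norm (X i - u0)) \<longlonglongrightarrow> 0"
      unfolding Y_def by (rule LIMSEQ_offset)
  qed
  moreover have "bounded_linear (\<lambda>h. J h * (LINT t|M. D u0 t))"
    by (rule bounded_linear_mult_const[OF J(1), unfolded o_def])
  ultimately show ?thesis
    unfolding has_derivative_at_within by simp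
qed

lemma isCont_integral_dominated:
  fixes f :: "real \<Rightarrow> 'm \<Rightarrow> complex"
  assumes "\<delta> > 0"
    and meas: "\<And>u. u \<in> ball u0 \<delta> \<Longrightarrow> f u \<in> borel_measurable M"
    and cont: "\<And>t. t \<in> space M \<Longrightarrow> isCont (\<lambda>u. f u t) u0"
    and w: "integrable M w"
    and bound: "\<And>u t. \<lbrakk>u \<in> ball u0 \<delta>; t \<in> space M\<rbrakk> \<Longrightarrow> norm (f u t) \<le> w t"
  shows "isCont (\<lambda>u. LINT t|M. f u t) u0"
  unfolding continuous_at_sequentially o_def
proof (intro allI impI)
  fix X assume X_lim: "X \<longlonglongrightarrow> u0"
  obtain N where N: "\<And>i. i \<ge> N \<Longrightarrow> X i \<in> ball u0 \<delta>"
    using X_lim \<open>\<delta> > 0\<close> unfolding lim_sequentially by (metis dist_commute mem_ball)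
  have "(\<lambda>i. LINT t|M. f (X (i + N)) t) \<longlonglongrightarrow> (LINT t|M. f u0 t)"
  proof (rule integral_dominated_convergence[where w = w])
    show "AE t in M. (\<lambda>i. f (X (i + N)) t) \<longlonglongrightarrow> f u0 t"
    proof (rule AE_I2)
      fix t assume "t \<in> space M"
      have "(\<lambda>i. f (X i) t) \<longlonglongrightarrow> f u0 t"
        using cont[OF \<open>t \<in> space M\<close>] X_lim unfolding continuous_at_sequentially o_def by blast
      thus "(\<lambda>i. f (X (i + N)) t) \<longlonglongrightarrow> f u0 t" by (rule LIMSEQ_ignore_initial_segment)
    qed
    show "AE t in M. norm (f (X (i + N)) t) \<le> w t" for i
      by (intro AE_I2 bound N) simp_all
    show "f (X (i + N)) \<in> borel_measurable M" for i by (intro meas N) simp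
  qed (use meas[of u0] \<open>\<delta> > 0\<close> w in auto)
  thus "(\<lambda>i. LINT t|M. f (X i) t) \<longlonglongrightarrow> (LINT t|M. f u0 t)" by (rule LIMSEQ_offset)
qed

section \<open>The kernel and its decay\<close>

text \<open>
  The factor \<open>t powr (z - 1)\<close> is written as an exponential because this makes measurability, the norm
  and both partial derivatives immediate; shifting \<open>z\<close> by \<open>1\<close> multiplies the kernel by \<open>t\<close>.
\<close>

definition bessel_kernel :: "complex \<Rightarrow> real \<Rightarrow> real \<Rightarrow> complex" where
  "bessel_kernel z x t =
     indicator {0<..} t *\<^sub>R exp (of_real (- t - x / t) + (z - 1) * of_real (ln t))"

text \<open>
  For \<open>x > 0\<close> this is \<open>2 x\<^bsup>z/2\<^esup> K\<^sub>z(2 \<surd>x)\<close>, the kernel of the transformation \<open>F\<close>.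
\<close>

definition rho :: "complex \<Rightarrow> real \<Rightarrow> complex" where
  "rho z x = (LBINT t. bessel_kernel z x t)"

text \<open>
  A majorant of \<open>rho z\<close> that depends on \<open>Re z\<close> only, so that it is uniform on vertical lines.
\<close>

definition rho_major :: "real \<Rightarrow> real \<Rightarrow> real" where
  "rho_major a x = (LBINT t. norm (bessel_kernel (of_real a) x t))"

lemma bessel_kernel_measurable [measurable]:
  "(\<lambda>(x, t). bessel_kernel z x t) \<in> borel_measurable (borel \<Otimes>\<^sub>M borel)"
  unfolding bessel_kernel_def by measurable

lemma bessel_kernel_measurable' [measurable]: "bessel_kernel z x \<in> borel_measurable borel"
  unfolding bessel_kernel_def by measurable

lemma norm_bessel_kernel:
  "norm (bessel_kernel z x t) = indicator {0<..} t * exp (- t - x / t + (Re z - 1) * ln t)"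
  by (simp add: bessel_kernel_def)

lemma norm_bessel_kernel_of_Re:
  "norm (bessel_kernel z x t) = norm (bessel_kernel (of_real (Re z)) x t)"
  by (simp add: norm_bessel_kernel)

lemma rho_measurable [measurable]: "rho z \<in> borel_measurable borel"
  unfolding rho_def by (rule lborel.borel_measurable_lebesgue_integral) measurable

lemma rho_major_measurable [measurable]: "rho_major a \<in> borel_measurable borel"
  unfolding rho_major_def by (rule lborel.borel_measurable_lebesgue_integral) measurable

text \<open>
  The factor \<open>e powr e\<close> comes from \<open>ln (u / e) \<le> u / e\<close>; it is not optimal.
\<close>

lemma powr_le_exp:
  fixes u e :: real
  assumes "e > 0" "u > 0"
  shows "u powr e \<le> e powr e * exp u"
proof -
  have "ln (u / e) \<le> u / e" using ln_le_minus_one[of "u / e"] assms by simp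
  hence "e * ln u \<le> e * ln e + u" using assms by (simp add: ln_div field_simps)
  hence "exp (e * ln u) \<le> exp (e * ln e + u)" by simp
  thus ?thesis using assms by (simp add: powr_def exp_add)
qed

lemma norm_bessel_kernel_bound:
  assumes "e > 0" "x > 0"
  shows "norm (bessel_kernel z x t) \<le>
    e powr e * x powr (- e) * (indicator {0<..} t * (t powr (Re z + e - 1) * exp (- t)))"
proof (cases "t > 0")
  case True
  have "(x / t) powr e \<le> e powr e * exp (x / t)" using assms True by (intro powr_le_exp) auto
  hence "exp (- (x / t)) \<le> e powr e * x powr (- e) * t powr e"
    using assms True by (simp add: exp_minus powr_divide powr_minus field_simps)
  hence "exp (- (x / t)) * (exp (- t) * t powr (Re z - 1))
      \<le> e powr e * x powr (- e) * t powr e * (exp (- t) * t powr (Re z - 1))"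
    by (rule mult_right_mono) simp
  moreover have "t powr (Re z + e - 1) = t powr e * t powr (Re z - 1)"
    by (simp add: powr_add[symmetric] algebra_simps)
  moreover have "norm (bessel_kernel z x t) = exp (- (x / t)) * (exp (- t) * t powr (Re z - 1))"
    using True by (simp add: norm_bessel_kernel powr_def exp_add[symmetric])
  ultimately show ?thesis using True by (simp add: mult_ac)
qed (simp add: norm_bessel_kernel)

lemma Gamma_integrand_integrable:
  assumes "a > 0"
  shows "integrable lborel (\<lambda>t::real. indicator {0<..} t * (t powr (a - 1) * exp (- t)))"
proof -
  have "integrable lebesgue
      (\<lambda>t. norm (indicat_real {0<..} t *\<^sub>R (complex_of_real t powr (of_real a - 1) / of_real (exp t))))"
    using absolutely_integrable_Gamma_integral'[of "of_real a"] assms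
    unfolding set_integrable_def by (intro integrable_norm) simp
  also have "(\<lambda>t. norm (indicat_real {0<..} t *\<^sub>R (complex_of_real t powr (of_real a - 1) / of_real (exp t))))
      = (\<lambda>t. indicator {0<..} t * (t powr (a - 1) * exp (- t)))"
    by (auto simp: fun_eq_iff indicator_def norm_divide norm_powr_real_powr exp_minus divide_simps)
  finally show ?thesis by (subst (asm) integrable_completion) auto
qed

lemma bessel_kernel_integrable:
  assumes "x > 0"
  shows "integrable lborel (bessel_kernel z x)"
proof -
  define e where "e = \<bar>Re z\<bar> + 1"
  have "e > 0" "Re z + e > 0" by (auto simp: e_def)
  show ?thesis
  proof (rule Bochner_Integration.integrable_bound)
    show "integrable lborel (\<lambda>t. e powr e * x powr (- e) *
            (indicator {0<..} t * (t powr (Re z + e - 1) * exp (- t))))"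
      using Gamma_integrand_integrable[OF \<open>Re z + e > 0\<close>] by simp
  qed (use norm_bessel_kernel_bound[OF \<open>e > 0\<close> \<open>x > 0\<close>, of z] in
        \<open>auto intro!: AE_I2 order_trans[OF _ abs_ge_self]\<close>)
qed

lemma norm_rho_le: "norm (rho z x) \<le> rho_major (Re z) x"
  unfolding rho_def rho_major_def
  using integral_norm_bound[of lborel "bessel_kernel z x"]
  by (simp add: norm_bessel_kernel_of_Re[symmetric])

lemma rho_major_nonneg: "rho_major a x \<ge> 0"
  unfolding rho_major_def by simp

text \<open>
  By \<open>powr_le_exp\<close>, \<open>exp (- x / t)\<close> is at most a constant times \<open>(t / x) powr e\<close>, which leaves a
  Gamma integral in \<open>t\<close>. The exponent \<open>e\<close> is free: a small one controls
  \<open>rho\<close> at \<open>0\<close>, a large one at infinity.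
\<close>

lemma rho_major_bound:
  assumes "e > 0" "a + e > 0"
  obtains C where "C \<ge> 0" "\<And>x. x > 0 \<Longrightarrow> rho_major a x \<le> C * x powr (- e)"
proof
  define G where "G = (LBINT t. indicator {0<..} t * (t powr (a + e - 1) * exp (- t)))"
  show "e powr e * G \<ge> 0" unfolding G_def by simp
  fix x :: real assume "x > 0"
  have "rho_major a x \<le> (LBINT t. e powr e * x powr (- e) *
            (indicator {0<..} t * (t powr (a + e - 1) * exp (- t))))"
    unfolding rho_major_def
    using norm_bessel_kernel_bound[OF \<open>e > 0\<close> \<open>x > 0\<close>, of "of_real a"]
      bessel_kernel_integrable[OF \<open>x > 0\<close>, of "of_real a"] Gamma_integrand_integrable[OF assms(2)]
    by (intro integral_mono) auto
  also have "\<dots> = e powr e * x powr (- e) * G"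
    unfolding G_def by (rule integral_mult_right_zero)
  finally show "rho_major a x \<le> e powr e * G * x powr (- e)"
    by (simp add: mult_ac)
qed

section \<open>Integrability against functions of power growth\<close>

lemma set_integrable_lborel_of_HK:
  fixes f :: "real \<Rightarrow> real"
  assumes "f integrable_on S" "\<And>x. x \<in> S \<Longrightarrow> f x \<ge> 0"
    and "f \<in> borel_measurable borel" "S \<in> sets borel"
  shows "set_integrable lborel S f"
proof -
  have "set_integrable lebesgue S f"
    using nonnegative_absolutely_integrable_1[OF assms(1,2)] by simp
  thus ?thesis
    using assms(3,4) unfolding set_integrable_def by (subst (asm) integrable_completion) auto
qed

lemma powr_integrable_near_0:
  fixes p :: real
  assumes "p > -1"
  shows "set_integrable lborel {0<..1} (\<lambda>x. x powr p)"
  by (rule set_integrable_lborel_of_HK) (use integrable_on_powr_from_0'[OF assms, of 1] in auto)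

lemma powr_integrable_at_infinity:
  fixes p y :: real
  assumes "p < -1" "y > 0"
  shows "set_integrable lborel {y..} (\<lambda>x. x powr p)"
  by (rule set_integrable_lborel_of_HK)
    (use has_integral_powr_to_inf[OF assms] in \<open>auto simp: integrable_on_def\<close>)

lemma set_integrable_mono_bound:
  fixes f :: "real \<Rightarrow> complex" and w :: "real \<Rightarrow> real"
  assumes "set_integrable lborel S w" "set_borel_measurable lborel S f"
    and "\<And>x. x \<in> S \<Longrightarrow> norm (f x) \<le> w x"
  shows "set_integrable lborel S f"
  using assms(1,2) unfolding set_integrable_def set_borel_measurable_def
proof (rule Bochner_Integration.integrable_bound)
  show "AE x in lborel. norm (indicat_real S x *\<^sub>R f x) \<le> norm (indicat_real S x *\<^sub>R w x)"
    using assms(3) by (intro AE_I2) (auto simp: indicator_def intro: order_trans[OF _ abs_ge_self])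
qed

lemma rho_major_powr_integrable_at_infinity:
  assumes "y > 0"
  shows "set_integrable lborel {y..} (\<lambda>x. rho_major a x * x powr (- c))"
proof -
  define e where "e = \<bar>a\<bar> + \<bar>c\<bar> + 2"
  have e: "e > 0" "a + e > 0" "- e - c < - 1" by (auto simp: e_def)
  obtain C where C: "C \<ge> 0" "\<And>x. x > 0 \<Longrightarrow> rho_major a x \<le> C * x powr (- e)"
    using rho_major_bound[OF e(1,2)] by blast
  have "set_integrable lborel {y..} (\<lambda>x. C * x powr (- e - c))"
    using powr_integrable_at_infinity[OF e(3) assms] by simp
  thus ?thesis
  proof (rule set_integrable_bound)
    show "AE x in lborel. x \<in> {y..} \<longrightarrow>
        norm (rho_major a x * x powr (- c)) \<le> norm (C * x powr (- e - c))"
    proof (intro AE_I2 impI)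
      fix x assume "x \<in> {y..}"
      hence "x > 0" using assms by simp
      have "rho_major a x * x powr (- c) \<le> C * x powr (- e) * x powr (- c)"
        using C(2)[OF \<open>x > 0\<close>] by (rule mult_right_mono) simp
      thus "norm (rho_major a x * x powr (- c)) \<le> norm (C * x powr (- e - c))"
        using C(1) by (simp add: abs_mult rho_major_nonneg mult.assoc powr_add[symmetric])
    qed
  qed (simp add: set_borel_measurable_def)
qed

text \<open>
  Near \<open>0\<close> the decay exponent \<open>e\<close> must satisfy \<open>e > 0\<close>, \<open>e > - a\<close> and \<open>e + c < 1\<close>; the two hypotheses
  say exactly that such an \<open>e\<close> exists. This is where the half-plane of the theorem comes from.
\<close>

lemma rho_major_powr_integrable:
  assumes "c < 1" "a > c - 1"
  shows "set_integrable lborel {0<..} (\<lambda>x. rho_major a x * x powr (- c))"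
proof -
  obtain e where e: "max 0 (- a) < e" "e < 1 - c"
    using dense[of "max 0 (- a)" "1 - c"] assms by auto
  obtain C where C: "C \<ge> 0" "\<And>x. x > 0 \<Longrightarrow> rho_major a x \<le> C * x powr (- e)"
    by (rule rho_major_bound[of e a]) (use e in auto)
  have "set_integrable lborel {0<..1} (\<lambda>x. C * x powr (- e - c))"
    using powr_integrable_near_0[of "- e - c"] e by simp
  hence near: "set_integrable lborel {0<..1} (\<lambda>x. rho_major a x * x powr (- c))"
  proof (rule set_integrable_bound)
    show "AE x in lborel. x \<in> {0<..1} \<longrightarrow>
        norm (rho_major a x * x powr (- c)) \<le> norm (C * x powr (- e - c))"
    proof (intro AE_I2 impI)
      fix x :: real assume "x \<in> {0<..1}"
      hence "x > 0" by simp
      have "rho_major a x * x powr (- c) \<le> C * x powr (- e) * x powr (- c)"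
        using C(2)[OF \<open>x > 0\<close>] by (rule mult_right_mono) simp
      thus "norm (rho_major a x * x powr (- c)) \<le> norm (C * x powr (- e - c))"
        using C(1) by (simp add: abs_mult rho_major_nonneg mult.assoc powr_add[symmetric])
    qed
  qed (simp add: set_borel_measurable_def)
  have "{0<..} = {0<..1} \<union> {1::real..}" by auto
  thus ?thesis
    using set_integrable_Un[OF near rho_major_powr_integrable_at_infinity[of 1 a c]] by simp
qed

lemma set_borel_measurable_mult_continuous:
  fixes g :: "real \<Rightarrow> complex"
  assumes "continuous_on {0<..} g" "S \<in> sets borel" "S \<subseteq> {0<..}"
    and r: "r \<in> borel_measurable borel"
  shows "set_borel_measurable lborel S (\<lambda>x. r x * g x)"
proof -
  have "(\<lambda>x. indicator S x *\<^sub>R g x) \<in> borel_measurable borel"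
    using borel_measurable_continuous_on_indicator[OF assms(2) continuous_on_subset[OF assms(1,3)]] .
  hence "(\<lambda>x. r x * (indicator S x *\<^sub>R g x)) \<in> borel_measurable borel"
    using r by (intro borel_measurable_times)
  thus ?thesis by (simp add: set_borel_measurable_def)
qed

lemma rho_mult_integrable:
  assumes g: "continuous_on {0<..} g" "\<And>x. x > 0 \<Longrightarrow> norm (g x) \<le> C * x powr (- c)"
    and "c < 1" "Re z > c - 1"
  shows "set_integrable lborel {0<..} (\<lambda>x. rho z x * g x)"
proof (rule set_integrable_mono_bound)
  show "set_integrable lborel {0<..} (\<lambda>x. C * (rho_major (Re z) x * x powr (- c)))"
    using rho_major_powr_integrable[OF assms(3,4)] by simp
  show "set_borel_measurable lborel {0<..} (\<lambda>x. rho z x * g x)"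
    by (rule set_borel_measurable_mult_continuous[OF g(1) _ _ rho_measurable]) auto
  fix x :: real assume "x \<in> {0<..}"
  hence "norm (g x) \<le> C * x powr (- c)" by (intro g(2)) simp
  hence "norm (rho z x) * norm (g x) \<le> rho_major (Re z) x * (C * x powr (- c))"
    by (intro mult_mono norm_rho_le rho_major_nonneg norm_ge_zero)
  thus "norm (rho z x * g x) \<le> C * (rho_major (Re z) x * x powr (- c))"
    unfolding norm_mult mult.left_commute[of C] .
qed

lemma rho_mult_integrable_at_infinity:
  assumes g: "continuous_on {0<..} g" "\<And>x. x > 0 \<Longrightarrow> norm (g x) \<le> C * x powr (- c)"
    and "y > 0"
  shows "set_integrable lborel {y..} (\<lambda>x. rho z x * g x)"
proof (rule set_integrable_mono_bound)
  show "set_integrable lborel {y..} (\<lambda>x. C * (rho_major (Re z) x * x powr (- c)))"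
    using rho_major_powr_integrable_at_infinity[OF assms(3)] by simp
  show "set_borel_measurable lborel {y..} (\<lambda>x. rho z x * g x)"
    using \<open>y > 0\<close> by (intro set_borel_measurable_mult_continuous[OF g(1) _ _ rho_measurable]) auto
  fix x :: real assume "x \<in> {y..}"
  hence "norm (g x) \<le> C * x powr (- c)" by (intro g(2)) (use \<open>y > 0\<close> in simp)
  hence "norm (rho z x) * norm (g x) \<le> rho_major (Re z) x * (C * x powr (- c))"
    by (intro mult_mono norm_rho_le rho_major_nonneg norm_ge_zero)
  thus "norm (rho z x * g x) \<le> C * (rho_major (Re z) x * x powr (- c))"
    unfolding norm_mult mult.left_commute[of C] .
qed

section \<open>Derivatives of the kernel\<close>

text \<open>
  Differentiating \<open>exp (- x / t)\<close> in \<open>x\<close> produces \<open>- 1 / t\<close>, which lowers the order by \<open>1\<close>. Since the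
  kernel decreases in \<open>x\<close>, its value at the left end of a neighbourhood dominates.
\<close>

lemma rho_has_vector_derivative:
  assumes "x > 0"
  shows "(rho (z + 1) has_vector_derivative - rho z x) (at x)"
proof -
  have "((\<lambda>u. LBINT t. bessel_kernel (z + 1) u t) has_derivative
      (\<lambda>h. of_real h * (LBINT t. - bessel_kernel z x t))) (at x)"
  proof (rule has_derivative_integral_dominated[where \<delta> = "x / 2" and D = "\<lambda>u t. - bessel_kernel z u t"
        and w = "\<lambda>t. norm (bessel_kernel z (x / 2) t)"])
    fix u :: real assume "u \<in> ball x (x / 2)"
    hence u: "u > x / 2" "u > 0" using assms by (auto simp: dist_real_def abs_if split: if_splits)
    show "integrable lborel (bessel_kernel (z + 1) u)" by (rule bessel_kernel_integrable[OF u(2)])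
    fix t :: real
    show "((\<lambda>u. bessel_kernel (z + 1) u t) has_derivative
        (\<lambda>h. of_real h * - bessel_kernel z u t)) (at u)"
    proof (cases "t > 0")
      case True
      define E where "E = (\<lambda>v. exp (- of_real t - v / of_real t + z * of_real (ln t) :: complex))"
      have "(E has_field_derivative E v * (- inverse (of_real t))) (at v)" for v
        unfolding E_def using True
        by (auto intro!: derivative_eq_intros simp: divide_inverse)
      hence "((\<lambda>u. E (of_real u)) has_vector_derivative E (of_real u) * (- inverse (of_real t))) (at u)"
        by (rule has_vector_derivative_real_field)
      moreover have "E (of_real u) = bessel_kernel (z + 1) u t" for u
        using True by (simp add: E_def bessel_kernel_def)
      moreover have "E (of_real u) * (- inverse (of_real t)) = - bessel_kernel z u t"
      proof -
        have "inverse (of_real t) = exp (- of_real (ln t) :: complex)"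
          using True by (simp add: exp_minus exp_of_real)
        moreover have "exp (- of_real t - of_real u / of_real t + z * of_real (ln t)) *
            exp (- of_real (ln t) :: complex) = bessel_kernel z u t"
          using True unfolding bessel_kernel_def by (simp add: exp_add[symmetric] algebra_simps)
        ultimately show ?thesis by (simp add: E_def)
      qed
      ultimately show ?thesis
        by (simp add: has_vector_derivative_def scaleR_conv_of_real)
    qed (simp add: bessel_kernel_def)
    show "norm (- bessel_kernel z u t) \<le> norm (bessel_kernel z (x / 2) t)"
    proof (cases "t > 0")
      case True
      hence "x / 2 / t \<le> u / t" using u by (intro divide_right_mono) auto
      thus ?thesis using True by (simp add: norm_bessel_kernel)
    qed (simp add: norm_bessel_kernel)
  qed (use assms bessel_kernel_integrable[of "x / 2" z] in
        \<open>auto intro: bounded_linear_of_real integrable_norm\<close>)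
  thus ?thesis
    by (simp add: rho_def[abs_def] has_vector_derivative_def scaleR_conv_of_real[abs_def])
qed

text \<open>
  The logarithm produced by a derivative in \<open>z\<close> is absorbed, up to \<open>1 / \<delta>\<close>, by \<open>t powr \<delta>\<close> for
  \<open>t \<ge> 1\<close> and by \<open>t powr - \<delta>\<close> for \<open>t \<le> 1\<close>; a second \<open>\<delta>\<close> absorbs the variation of \<open>Re z\<close>. Adding
  both cases gives a majorant that is uniform in the strip.
\<close>

lemma norm_ln_bessel_kernel_le:
  assumes "\<delta> > 0" "\<bar>Re z - a\<bar> \<le> \<delta>"
  shows "norm (of_real (ln t) * bessel_kernel z x t) \<le>
    (norm (bessel_kernel (of_real (a + 2 * \<delta>)) x t) +
     norm (bessel_kernel (of_real (a - 2 * \<delta>)) x t)) / \<delta>"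
proof (cases "t > 0")
  case True
  define l where "l = ln t"
  have "\<delta> * (\<bar>l\<bar> * exp ((Re z - 1) * l)) \<le>
      exp ((a + 2 * \<delta> - 1) * l) + exp ((a - 2 * \<delta> - 1) * l)"
  proof (cases "l \<ge> 0")
    case True
    have "(\<delta> * l) * exp ((Re z - 1) * l) \<le> exp (\<delta> * l) * exp ((a + \<delta> - 1) * l)"
    proof (rule mult_mono)
      show "\<delta> * l \<le> exp (\<delta> * l)" using exp_ge_add_one_self[of "\<delta> * l"] by linarith
    qed (use assms True in \<open>auto intro!: mult_right_mono\<close>)
    also have "\<dots> = exp ((a + 2 * \<delta> - 1) * l)"
      by (simp add: exp_add[symmetric] algebra_simps)
    finally show ?thesis using True by (simp add: mult_ac add_increasing2)
  next
    case False
    have "(\<delta> * - l) * exp ((Re z - 1) * l) \<le> exp (\<delta> * - l) * exp ((a - \<delta> - 1) * l)"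
    proof (rule mult_mono)
      show "\<delta> * - l \<le> exp (\<delta> * - l)" using exp_ge_add_one_self[of "\<delta> * - l"] by linarith
    qed (use assms False in \<open>auto intro!: mult_right_mono_neg\<close>)
    also have "\<dots> = exp ((a - 2 * \<delta> - 1) * l)"
      by (simp add: exp_add[symmetric] algebra_simps)
    finally show ?thesis using False by (simp add: mult_ac add_increasing)
  qed
  hence "exp (- t - x / t) * (\<delta> * (\<bar>l\<bar> * exp ((Re z - 1) * l))) \<le>
      exp (- t - x / t) * (exp ((a + 2 * \<delta> - 1) * l) + exp ((a - 2 * \<delta> - 1) * l))"
    by (intro mult_left_mono) auto
  moreover have "norm (bessel_kernel w x t) = exp (- t - x / t) * exp ((Re w - 1) * l)" for w
    using True by (simp add: norm_bessel_kernel l_def exp_add)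
  ultimately show ?thesis
    using \<open>\<delta> > 0\<close> by (simp add: norm_mult l_def pos_le_divide_eq algebra_simps)
qed (simp add: bessel_kernel_def)

definition rho_deriv :: "complex \<Rightarrow> real \<Rightarrow> complex" where
  "rho_deriv z x = (LBINT t. of_real (ln t) * bessel_kernel z x t)"

lemma rho_deriv_measurable [measurable]: "rho_deriv z \<in> borel_measurable borel"
  unfolding rho_deriv_def by (rule lborel.borel_measurable_lebesgue_integral) measurable

lemma norm_rho_deriv_le:
  assumes "\<delta> > 0" "\<bar>Re z - a\<bar> \<le> \<delta>" "x > 0"
  shows "norm (rho_deriv z x) \<le> (rho_major (a + 2 * \<delta>) x + rho_major (a - 2 * \<delta>) x) / \<delta>"
proof -
  define w where "w t = (norm (bessel_kernel (of_real (a + 2 * \<delta>)) x t) +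
     norm (bessel_kernel (of_real (a - 2 * \<delta>)) x t)) / \<delta>" for t
  have w: "integrable lborel w"
    unfolding w_def using bessel_kernel_integrable[OF \<open>x > 0\<close>] by (intro integrable_divide Bochner_Integration.integrable_add) auto
  have le: "norm (of_real (ln t) * bessel_kernel z x t) \<le> w t" for t
    unfolding w_def by (rule norm_ln_bessel_kernel_le[OF assms(1,2)])
  have "norm (rho_deriv z x) \<le> (LBINT t. w t)"
    unfolding rho_deriv_def
  proof (rule Bochner_Integration.integral_norm_bound_integral[OF _ w le])
    show "integrable lborel (\<lambda>t. of_real (ln t) * bessel_kernel z x t)"
      by (rule Bochner_Integration.integrable_bound[OF w])
        (use le in \<open>auto intro: order_trans[OF _ abs_ge_self]\<close>)
  qed
  also have "\<dots> = (rho_major (a + 2 * \<delta>) x + rho_major (a - 2 * \<delta>) x) / \<delta>"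
    unfolding w_def rho_major_def
    using bessel_kernel_integrable[OF \<open>x > 0\<close>] by (simp del: of_real_add of_real_diff)
  finally show ?thesis .
qed

lemma rho_has_field_derivative:
  assumes "x > 0"
  shows "((\<lambda>z. rho z x) has_field_derivative rho_deriv z x) (at z)"
proof -
  have "((\<lambda>z. LBINT t. bessel_kernel z x t) has_derivative
      (\<lambda>h. id h * (LBINT t. of_real (ln t) * bessel_kernel z x t))) (at z)"
  proof (rule has_derivative_integral_dominated[where \<delta> = 1
        and D = "\<lambda>z t. of_real (ln t) * bessel_kernel z x t"
        and w = "\<lambda>t. (norm (bessel_kernel (of_real (Re z + 2 * 1)) x t) +
          norm (bessel_kernel (of_real (Re z - 2 * 1)) x t)) / 1"])
    fix u assume u: "u \<in> ball z 1"
    show "integrable lborel (bessel_kernel u x)" by (rule bessel_kernel_integrable[OF assms])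
    fix t :: real
    show "((\<lambda>u. bessel_kernel u x t) has_derivative
        (\<lambda>h. id h * (of_real (ln t) * bessel_kernel u x t))) (at u)"
    proof (cases "t > 0")
      case True
      have "((\<lambda>u. exp (of_real (- t - x / t) + (u - 1) * of_real (ln t))) has_field_derivative
          of_real (ln t) * exp (of_real (- t - x / t) + (u - 1) * of_real (ln t))) (at u)"
        by (auto intro!: derivative_eq_intros)
      thus ?thesis using True
        by (simp add: bessel_kernel_def has_field_derivative_def mult_commute_abs)
    qed (simp add: bessel_kernel_def)
    have "norm (u - z) \<le> 1" using u by (simp add: dist_norm norm_minus_commute)
    hence "\<bar>Re u - Re z\<bar> \<le> 1" using abs_Re_le_cmod[of "u - z"] by simp
    thus "norm (of_real (ln t) * bessel_kernel u x t) \<le>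
        (norm (bessel_kernel (of_real (Re z + 2 * 1)) x t) +
          norm (bessel_kernel (of_real (Re z - 2 * 1)) x t)) / 1"
      by (intro norm_ln_bessel_kernel_le) auto
  qed (use bessel_kernel_integrable[OF assms] in
        \<open>auto intro!: bounded_linear_ident[folded id_def] integrable_norm simp del: of_real_add of_real_diff\<close>)
  thus ?thesis
    by (simp add: rho_def rho_deriv_def has_field_derivative_def mult.commute[of "LBINT t. _ t"] mult_commute_abs)
qed

text \<open>
  The derivative of \<open>rho\<close> in \<open>z\<close> is bounded on a small disc by \<open>rho_major\<close> at the two orders
  \<open>a \<plusminus> 2 \<delta>\<close>. With \<open>\<delta>\<close> a quarter of the distance to the boundary of the half-plane both orders stay
  inside it, hence the outer integral may be differentiated as well.
\<close>

lemma rho_transform_holomorphic: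
  assumes g: "continuous_on {0<..} g" "\<And>x. x > 0 \<Longrightarrow> norm (g x) \<le> C * x powr (- c)"
    and "c < 1"
  shows "(\<lambda>z. LBINT x:{0<..}. rho z x * g x) holomorphic_on {z. Re z > c - 1}"
proof -
  define G where "G x = indicator {0<..} x *\<^sub>R g x" for x :: real
  have G_meas [measurable]: "G \<in> borel_measurable borel"
    unfolding G_def by (rule borel_measurable_continuous_on_indicator[OF _ g(1)]) simp
  have "((\<lambda>z. LBINT x. rho z x * G x) has_field_derivative (LBINT x. rho_deriv z x * G x)) (at z)"
    if z: "Re z > c - 1" for z
  proof -
    define a where "a = Re z"
    define \<delta> where "\<delta> = (a - (c - 1)) / 4"
    have \<delta>: "\<delta> > 0" "a - 2 * \<delta> > c - 1" "a + 2 * \<delta> > c - 1"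
      using z by (auto simp: \<delta>_def a_def field_simps)
    define m where "m b x = indicator {0<..} x * (rho_major b x * x powr (- c))" for b x :: real
    have m_int: "integrable lborel (m b)" if "b > c - 1" for b
      using rho_major_powr_integrable[OF \<open>c < 1\<close> that] by (simp add: set_integrable_def m_def[abs_def])
    have "((\<lambda>z. LBINT x. rho z x * G x) has_derivative
        (\<lambda>h. id h * (LBINT x. rho_deriv z x * G x))) (at z)"
    proof (rule has_derivative_integral_dominated[where \<delta> = \<delta> and D = "\<lambda>z x. rho_deriv z x * G x"
          and w = "\<lambda>x. C / \<delta> * (m (a + 2 * \<delta>) x + m (a - 2 * \<delta>) x)"])
      fix u assume u: "u \<in> ball z \<delta>"
      have "norm (u - z) \<le> \<delta>" using u by (simp add: dist_norm norm_minus_commute)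
      hence Re_u: "\<bar>Re u - a\<bar> \<le> \<delta>" using abs_Re_le_cmod[of "u - z"] by (simp add: a_def)
      hence "Re u > c - 1" using \<delta> by linarith
      thus "integrable lborel (\<lambda>x. rho u x * G x)"
        using rho_mult_integrable[OF g \<open>c < 1\<close>] by (simp add: set_integrable_def G_def)
      fix x :: real
      show "((\<lambda>z. rho z x * G x) has_derivative (\<lambda>h. id h * (rho_deriv u x * G x))) (at u)"
      proof (cases "x > 0")
        case True
        have "((\<lambda>z. rho z x * G x) has_field_derivative rho_deriv u x * G x) (at u)"
          by (rule DERIV_cmult_right[OF rho_has_field_derivative[OF True]])
        thus ?thesis by (simp add: has_field_derivative_def mult_commute_abs)
      qed (simp add: G_def)
      show "norm (rho_deriv u x * G x) \<le> C / \<delta> * (m (a + 2 * \<delta>) x + m (a - 2 * \<delta>) x)"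
      proof (cases "x > 0")
        case True
        have "norm (rho_deriv u x) * norm (g x) \<le>
            (rho_major (a + 2 * \<delta>) x + rho_major (a - 2 * \<delta>) x) / \<delta> * (C * x powr (- c))"
          by (intro mult_mono norm_rho_deriv_le \<delta>(1) Re_u True g(2) norm_ge_zero)
            (use \<delta>(1) in \<open>simp add: rho_major_nonneg\<close>)
        thus ?thesis using True by (simp add: G_def m_def norm_mult algebra_simps add_divide_distrib)
      qed (simp add: G_def m_def)
    qed (use \<delta> m_int in \<open>auto intro!: bounded_linear_ident[folded id_def]\<close>)
    thus ?thesis by (simp add: has_field_derivative_def mult_commute_abs)
  qed
  hence "(\<lambda>z. LBINT x. rho z x * G x) holomorphic_on {z. Re z > c - 1}"
    unfolding holomorphic_on_def field_differentiable_def
    using has_field_derivative_at_within by blast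
  thus ?thesis by (simp add: G_def set_lebesgue_integral_def)
qed

section \<open>Integration by parts\<close>

lemma rho_tendsto_0_at_infinity:
  assumes "\<And>x. x > 0 \<Longrightarrow> norm (g x) \<le> C * x powr (- c)"
  shows "((\<lambda>x. rho z x * g x) \<longlongrightarrow> 0) at_top"
proof -
  define e where "e = \<bar>Re z\<bar> + \<bar>c\<bar> + 1"
  have e: "e > 0" "Re z + e > 0" "- e - c < 0" by (auto simp: e_def)
  obtain B where B: "B \<ge> 0" "\<And>x. x > 0 \<Longrightarrow> rho_major (Re z) x \<le> B * x powr (- e)"
    using rho_major_bound[OF e(1,2)] by blast
  have "((\<lambda>x. B * C * x powr (- e - c)) \<longlongrightarrow> B * C * 0) at_top"
    by (intro tendsto_intros tendsto_neg_powr e filterlim_ident)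
  hence "((\<lambda>x. B * C * x powr (- e - c)) \<longlongrightarrow> 0) at_top" by simp
  thus ?thesis
  proof (rule Lim_null_comparison[rotated])
    show "\<forall>\<^sub>F x in at_top. norm (rho z x * g x) \<le> B * C * x powr (- e - c)"
      using eventually_gt_at_top[of 0]
    proof eventually_elim
      case (elim x)
      have "norm (rho z x) * norm (g x) \<le> B * x powr (- e) * (C * x powr (- c))"
        using B(1) by (intro mult_mono order_trans[OF norm_rho_le B(2)] assms elim) auto
      also have "\<dots> = B * C * x powr (- e - c)"
        using powr_add[of x "- e" "- c"] by (simp add: mult_ac)
      finally show ?case by (simp add: norm_mult)
    qed
  qed
qed

lemma rho_tendsto_0_at_right:
  assumes "\<And>x. x > 0 \<Longrightarrow> norm (g x) \<le> C * x powr (- c)" and "c < 0" "Re z > c"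
  shows "((\<lambda>x. rho z x * g x) \<longlongrightarrow> 0) (at_right 0)"
proof -
  \<comment> \<open>The product will be bounded by a multiple of \<open>x powr (- e - c)\<close>, which tends to \<open>0\<close> if \<open>e < - c\<close>.\<close>
  obtain e where e: "max 0 (- Re z) < e" "e < - c"
    using dense[of "max 0 (- Re z)" "- c"] assms by auto
  obtain B where B: "B \<ge> 0" "\<And>x. x > 0 \<Longrightarrow> rho_major (Re z) x \<le> B * x powr (- e)"
    by (rule rho_major_bound[of e "Re z"]) (use e in auto)
  have "((\<lambda>x::real. B * C * x powr (- e - c)) \<longlongrightarrow> B * C * 0 powr (- e - c)) (at_right 0)"
    using e by (intro tendsto_intros tendsto_powr2) (auto intro: eventually_at_right_less eventually_mono)
  hence "((\<lambda>x::real. B * C * x powr (- e - c)) \<longlongrightarrow> 0) (at_right 0)" by simp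
  thus ?thesis
  proof (rule Lim_null_comparison[rotated])
    show "\<forall>\<^sub>F x in at_right 0. norm (rho z x * g x) \<le> B * C * x powr (- e - c)"
      using eventually_at_right_less[of 0]
    proof eventually_elim
      case (elim x)
      have "norm (rho z x) * norm (g x) \<le> B * x powr (- e) * (C * x powr (- c))"
        using B(1) by (intro mult_mono order_trans[OF norm_rho_le B(2)] assms elim) auto
      also have "\<dots> = B * C * x powr (- e - c)"
        using powr_add[of x "- e" "- c"] by (simp add: mult_ac)
      finally show ?case by (simp add: norm_mult)
    qed
  qed
qed

text \<open>
  By \<open>rho_has_vector_derivative\<close>, \<open>- rho (z + 1) g\<close> is an antiderivative of
  \<open>rho z g - rho (z + 1) g'\<close>, and it vanishes at infinity. The boundary value \<open>L\<close> is kept abstract so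
  that one statement covers both \<open>y > 0\<close>, where it is the value at \<open>y\<close>, and \<open>y = 0\<close>, where it
  vanishes in the situation of \<open>rho_tendsto_0_at_right\<close>.
\<close>

lemma rho_integration_by_parts:
  fixes g :: "real \<Rightarrow> complex"
  assumes der: "\<And>x. x > 0 \<Longrightarrow> (g has_vector_derivative g' x) (at x)"
    and g'_cont: "continuous_on {0<..} g'"
    and g: "\<And>x. x > 0 \<Longrightarrow> norm (g x) \<le> C * x powr (- c)"
    and "y \<ge> 0"
    and int: "set_integrable lborel {y<..} (\<lambda>x. rho z x * g x)"
      "set_integrable lborel {y<..} (\<lambda>x. rho (z + 1) x * g' x)"
    and lim: "((\<lambda>x. rho (z + 1) x * g x) \<longlongrightarrow> L) (at_right y)"
  shows "(LBINT x:{y<..}. rho z x * g x) = L + (LBINT x:{y<..}. rho (z + 1) x * g' x)"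
proof -
  have rho_cont: "isCont (rho w) x" if "x > 0" for w x
    using has_vector_derivative_continuous[OF rho_has_vector_derivative[OF that, of "w - 1"]] by simp
  have "(LBINT x=ereal y..\<infinity>. rho z x * g x - rho (z + 1) x * g' x) = 0 - (- L)"
  proof (rule interval_integral_FTC_integrable[where F = "\<lambda>x. - (rho (z + 1) x * g x)"])
    fix x assume "ereal y < ereal x"
    hence x: "x > 0" using \<open>y \<ge> 0\<close> by simp
    show "((\<lambda>x. - (rho (z + 1) x * g x)) has_vector_derivative
        rho z x * g x - rho (z + 1) x * g' x) (at x)"
      using rho_has_vector_derivative[OF x, of z] der[OF x]
      by (auto intro!: derivative_eq_intros)
    have "isCont g x" using has_vector_derivative_continuous[OF der[OF x]] .
    moreover have "isCont g' x"
      using g'_cont x by (simp add: continuous_on_eq_continuous_at)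
    ultimately show "isCont (\<lambda>x. rho z x * g x - rho (z + 1) x * g' x) x"
      by (intro continuous_intros rho_cont x)
  next
    show "set_integrable lborel (einterval (ereal y) \<infinity>) (\<lambda>x. rho z x * g x - rho (z + 1) x * g' x)"
      using set_integral_diff(1)[OF int] by simp
    show "(((\<lambda>x. - (rho (z + 1) x * g x)) \<circ> real_of_ereal) \<longlongrightarrow> - L) (at_right (ereal y))"
      unfolding ereal_tendsto_simps by (intro tendsto_minus lim)
    show "(((\<lambda>x. - (rho (z + 1) x * g x)) \<circ> real_of_ereal) \<longlongrightarrow> 0) (at_left \<infinity>)"
      unfolding ereal_tendsto_simps
      using tendsto_minus[OF rho_tendsto_0_at_infinity[OF g]] by simp
  qed simp_all
  thus ?thesis
    using set_integral_diff(2)[OF int] by (simp add: interval_integral_to_infinity_eq algebra_simps)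
qed

section \<open>Derivatives of Mellin inversion integrals\<close>

text \<open>
  The formal \<open>k\<close>-th derivative in \<open>x\<close> of the Mellin inversion integral whose density on the line is
  \<open>h\<close>: differentiating \<open>x\<^bsup>-s\<^esup>\<close> repeatedly gives \<open>(-1)\<^sup>k s (s + 1) \<dots> (s + k - 1) x\<^bsup>-s-k\<^esup>\<close>. The power of
  \<open>x\<close> has constant modulus on the line, which is why the growth exponent is \<open>- c0 - k\<close> and why
  integrability does not depend on \<open>x\<close>.
\<close>

definition mellin_inversion_deriv :: "real \<Rightarrow> (real \<Rightarrow> complex) \<Rightarrow> nat \<Rightarrow> real \<Rightarrow> complex" where
  "mellin_inversion_deriv c0 h k x =
     (LBINT t. (-1) ^ k * (pochhammer (Complex c0 t) k * h t) *
        of_real x powr (- (Complex c0 t + of_nat k)))"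

lemma Complex_measurable [measurable]: "Complex c0 \<in> borel_measurable borel"
  by (intro borel_measurable_continuous_onI continuous_intros)

text \<open>
  Covers both signs of the exponent at once, for local domination in \<open>x\<close>.
\<close>

lemma powr_le_endpoints:
  fixes a b u p :: real
  assumes "0 < a" "a \<le> u" "u \<le> b"
  shows "u powr p \<le> a powr p + b powr p"
proof (cases "p \<ge> 0")
  case True
  thus ?thesis using powr_mono2[of p u b] assms by (simp add: add_increasing)
next
  case False
  thus ?thesis using powr_mono2'[of p a u] assms by (simp add: add_increasing2)
qed

lemma norm_of_real_powr_vertical:
  assumes "x > 0"
  shows "norm (of_real x powr (- (Complex c0 t + of_nat k))) = x powr (- (c0 + real k))"
  using assms by (simp add: norm_powr_real_powr)

lemma mellin_integrand_integrable:
  assumes int: "integrable lborel (\<lambda>t. pochhammer (Complex c0 t) k * h t)" and "x > 0"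
  shows "integrable lborel (\<lambda>t. (-1) ^ k * (pochhammer (Complex c0 t) k * h t) *
        of_real x powr (- (Complex c0 t + of_nat k)))"
proof (rule Bochner_Integration.integrable_bound)
  show "integrable lborel (\<lambda>t. x powr (- (c0 + real k)) * norm (pochhammer (Complex c0 t) k * h t))"
    using int by (intro integrable_mult_right integrable_norm)
  show "(\<lambda>t. (-1) ^ k * (pochhammer (Complex c0 t) k * h t) *
        of_real x powr (- (Complex c0 t + of_nat k))) \<in> borel_measurable lborel"
    using borel_measurable_integrable[OF int] unfolding powr_def by measurable
  show "AE t in lborel. norm ((-1) ^ k * (pochhammer (Complex c0 t) k * h t) *
        of_real x powr (- (Complex c0 t + of_nat k))) \<le>
      norm (x powr (- (c0 + real k)) * norm (pochhammer (Complex c0 t) k * h t))"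
    using norm_of_real_powr_vertical[OF \<open>x > 0\<close>, of c0 _ k] by (simp add: norm_mult norm_power)
qed

lemma norm_mellin_inversion_deriv_le:
  assumes "x > 0"
  shows "norm (mellin_inversion_deriv c0 h k x) \<le>
    (LBINT t. norm (pochhammer (Complex c0 t) k * h t)) * x powr (- (c0 + real k))"
proof -
  have "norm (mellin_inversion_deriv c0 h k x) \<le>
      (LBINT t. norm ((-1) ^ k * (pochhammer (Complex c0 t) k * h t) *
        of_real x powr (- (Complex c0 t + of_nat k))))"
    unfolding mellin_inversion_deriv_def by (rule integral_norm_bound)
  also have "\<dots> = (LBINT t. norm (pochhammer (Complex c0 t) k * h t) * x powr (- (c0 + real k)))"
    using norm_of_real_powr_vertical[OF assms, of c0 _ k] by (simp add: norm_mult norm_power)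
  also have "\<dots> = (LBINT t. norm (pochhammer (Complex c0 t) k * h t)) * x powr (- (c0 + real k))"
    by (rule integral_mult_left_zero)
  finally show ?thesis .
qed

lemma mellin_inversion_deriv_has_vector_derivative:
  assumes int: "integrable lborel (\<lambda>t. pochhammer (Complex c0 t) k * h t)"
    and int': "integrable lborel (\<lambda>t. pochhammer (Complex c0 t) (Suc k) * h t)"
    and x: "x > 0"
  shows "(mellin_inversion_deriv c0 h k has_vector_derivative
    mellin_inversion_deriv c0 h (Suc k) x) (at x)"
proof -
  define D where "D u t = (-1) ^ Suc k * (pochhammer (Complex c0 t) (Suc k) * h t) *
      complex_of_real u powr (- (Complex c0 t + of_nat (Suc k)))" for u t :: real
  define p where "p = - (c0 + real (Suc k))"
  have "(mellin_inversion_deriv c0 h k has_derivative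
      (\<lambda>v. of_real v * (LBINT t. D x t))) (at x)"
    unfolding mellin_inversion_deriv_def[abs_def]
  proof (rule has_derivative_integral_dominated[where \<delta> = "x / 2"
        and w = "\<lambda>t. norm (pochhammer (Complex c0 t) (Suc k) * h t) *
          ((x / 2) powr p + (3 * x / 2) powr p)"])
    fix u assume u_ball: "u \<in> ball x (x / 2)"
    hence u: "u > 0" "x / 2 \<le> u" "u \<le> 3 * x / 2"
      using x by (auto simp: dist_real_def abs_if split: if_splits)
    show "integrable lborel (\<lambda>t. (-1) ^ k * (pochhammer (Complex c0 t) k * h t) *
        of_real u powr (- (Complex c0 t + of_nat k)))"
      by (rule mellin_integrand_integrable[OF int u(1)])
    fix t :: real
    define s where "s = Complex c0 t + of_nat k"
    have "((\<lambda>v. v powr (- s)) has_field_derivative - s * of_real u powr (- s - 1)) (at (of_real u))"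
      using u by (intro has_field_derivative_powr) (simp add: complex_nonpos_Reals_iff)
    hence "((\<lambda>u. of_real u powr (- s)) has_vector_derivative - s * of_real u powr (- s - 1)) (at u)"
      by (rule has_vector_derivative_real_field)
    hence "((\<lambda>u. (-1) ^ k * (pochhammer (Complex c0 t) k * h t) * of_real u powr (- s))
        has_vector_derivative (-1) ^ k * (pochhammer (Complex c0 t) k * h t) *
          (- s * of_real u powr (- s - 1))) (at u)"
      by (rule has_vector_derivative_mult_right)
    also have "(-1) ^ k * (pochhammer (Complex c0 t) k * h t) * (- s * of_real u powr (- s - 1)) = D u t"
    proof -
      have "- s - 1 = - (Complex c0 t + of_nat (Suc k))" by (simp add: s_def)
      moreover define P where "P = complex_of_real u powr (- s - 1)"
      ultimately have "D u t = (-1) ^ Suc k * (pochhammer (Complex c0 t) (Suc k) * h t) * P"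
        by (simp only: D_def)
      thus ?thesis
        unfolding P_def[symmetric] by (simp add: pochhammer_Suc s_def algebra_simps)
    qed
    finally show "((\<lambda>u. (-1) ^ k * (pochhammer (Complex c0 t) k * h t) *
        of_real u powr (- (Complex c0 t + of_nat k))) has_derivative (\<lambda>v. of_real v * D u t)) (at u)"
      by (simp add: has_vector_derivative_def scaleR_conv_of_real s_def)
    have "norm (D u t) = norm (pochhammer (Complex c0 t) (Suc k) * h t) * u powr p"
      unfolding D_def p_def using norm_of_real_powr_vertical[OF u(1), of c0 t "Suc k"]
      by (simp add: norm_mult norm_power)
    also have "\<dots> \<le> norm (pochhammer (Complex c0 t) (Suc k) * h t) *
          ((x / 2) powr p + (3 * x / 2) powr p)"
      using x u by (intro mult_left_mono powr_le_endpoints) auto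
    finally show "norm (D u t) \<le> norm (pochhammer (Complex c0 t) (Suc k) * h t) *
          ((x / 2) powr p + (3 * x / 2) powr p)" .
  next
    show "D x \<in> borel_measurable lborel"
      using borel_measurable_integrable[OF mellin_integrand_integrable[OF int' x]]
      by (simp add: D_def[abs_def])
    show "integrable lborel (\<lambda>t. norm (pochhammer (Complex c0 t) (Suc k) * h t) *
          ((x / 2) powr p + (3 * x / 2) powr p))"
      using int' by (intro integrable_mult_left integrable_norm)
  qed (use x in \<open>auto intro: bounded_linear_of_real\<close>)
  thus ?thesis
    unfolding has_vector_derivative_def scaleR_conv_of_real
    by (simp add: D_def[abs_def] mellin_inversion_deriv_def)
qed

lemma isCont_mellin_inversion_deriv:
  assumes int: "integrable lborel (\<lambda>t. pochhammer (Complex c0 t) k * h t)" and x: "x > 0"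
  shows "isCont (mellin_inversion_deriv c0 h k) x"
proof -
  define p where "p = - (c0 + real k)"
  show ?thesis
    unfolding mellin_inversion_deriv_def[abs_def]
  proof (rule isCont_integral_dominated[where \<delta> = "x / 2"
        and w = "\<lambda>t. norm (pochhammer (Complex c0 t) k * h t) *
          ((x / 2) powr p + (3 * x / 2) powr p)"])
    fix u assume u_ball: "u \<in> ball x (x / 2)"
    hence u: "u > 0" "x / 2 \<le> u" "u \<le> 3 * x / 2"
      using x by (auto simp: dist_real_def abs_if split: if_splits)
    show "(\<lambda>t. (-1) ^ k * (pochhammer (Complex c0 t) k * h t) *
        of_real u powr (- (Complex c0 t + of_nat k))) \<in> borel_measurable lborel"
      using borel_measurable_integrable[OF mellin_integrand_integrable[OF int u(1)]] .
    fix t :: real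
    have "norm ((-1) ^ k * (pochhammer (Complex c0 t) k * h t) *
        of_real u powr (- (Complex c0 t + of_nat k))) =
        norm (pochhammer (Complex c0 t) k * h t) * u powr p"
      unfolding p_def using norm_of_real_powr_vertical[OF u(1), of c0 t k]
      by (simp add: norm_mult norm_power)
    also have "\<dots> \<le> norm (pochhammer (Complex c0 t) k * h t) *
          ((x / 2) powr p + (3 * x / 2) powr p)"
      using x u by (intro mult_left_mono powr_le_endpoints) auto
    finally show "norm ((-1) ^ k * (pochhammer (Complex c0 t) k * h t) *
        of_real u powr (- (Complex c0 t + of_nat k))) \<le>
        norm (pochhammer (Complex c0 t) k * h t) * ((x / 2) powr p + (3 * x / 2) powr p)" .
  next
    fix t :: real
    show "isCont (\<lambda>u. (-1) ^ k * (pochhammer (Complex c0 t) k * h t) *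
        of_real u powr (- (Complex c0 t + of_nat k))) x"
      using x by (intro continuous_intros) (auto simp: complex_nonpos_Reals_iff)
  next
    show "integrable lborel (\<lambda>t. norm (pochhammer (Complex c0 t) k * h t) *
          ((x / 2) powr p + (3 * x / 2) powr p))"
      using int by (intro integrable_mult_left integrable_norm)
  qed (use x in auto)
qed

lemma power_mult_integrable_on_vertical_line:
  assumes int: "integrable lborel (\<lambda>t. Complex c0 t ^ n * h t)" and "c0 \<noteq> 0" "j \<le> n"
  shows "integrable lborel (\<lambda>t. Complex c0 t ^ j * h t)"
proof -
  have nz: "Complex c0 t \<noteq> 0" for t using \<open>c0 \<noteq> 0\<close> by (simp add: complex_eq_iff)
  have eq: "Complex c0 t ^ j * h t = inverse (Complex c0 t ^ (n - j)) * (Complex c0 t ^ n * h t)" for t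
    using nz[of t] \<open>j \<le> n\<close> by (simp add: power_diff field_simps)
  show ?thesis
  proof (rule Bochner_Integration.integrable_bound)
    show "integrable lborel (\<lambda>t. inverse (\<bar>c0\<bar> ^ (n - j)) * norm (Complex c0 t ^ n * h t))"
      using int by (intro integrable_mult_right integrable_norm)
    show "(\<lambda>t. Complex c0 t ^ j * h t) \<in> borel_measurable lborel"
      unfolding eq using borel_measurable_integrable[OF int] by measurable
    show "AE t in lborel. norm (Complex c0 t ^ j * h t) \<le>
        norm (inverse (\<bar>c0\<bar> ^ (n - j)) * norm (Complex c0 t ^ n * h t))"
    proof (rule AE_I2)
      fix t :: real
      have "\<bar>c0\<bar> \<le> norm (Complex c0 t)" using abs_Re_le_cmod[of "Complex c0 t"] by simp
      hence "inverse (norm (Complex c0 t) ^ (n - j)) \<le> inverse (\<bar>c0\<bar> ^ (n - j))"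
        using \<open>c0 \<noteq> 0\<close> by (intro le_imp_inverse_le power_mono) auto
      thus "norm (Complex c0 t ^ j * h t) \<le>
          norm (inverse (\<bar>c0\<bar> ^ (n - j)) * norm (Complex c0 t ^ n * h t))"
        unfolding eq norm_mult[of "inverse _"] norm_inverse norm_power
        by (auto intro!: mult_right_mono simp: abs_mult)
    qed
  qed
qed

text \<open>
  The index \<open>j\<close> is needed for the induction: the new factor \<open>s + k\<close> of the Pochhammer symbol splits
  into a summand with one more power of \<open>s\<close> and one with a constant factor.
\<close>

lemma power_pochhammer_integrable:
  assumes "\<And>j. j \<le> n \<Longrightarrow> integrable lborel (\<lambda>t. Complex c0 t ^ j * h t)" and "j + k \<le> n"
  shows "integrable lborel (\<lambda>t. Complex c0 t ^ j * (pochhammer (Complex c0 t) k * h t))"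
  using assms(2)
proof (induction k arbitrary: j)
  case 0
  thus ?case using assms(1)[of j] by simp
next
  case (Suc k)
  have "integrable lborel (\<lambda>t. Complex c0 t ^ Suc j * (pochhammer (Complex c0 t) k * h t) +
      of_nat k * (Complex c0 t ^ j * (pochhammer (Complex c0 t) k * h t)))"
    using Suc.prems by (intro Bochner_Integration.integrable_add integrable_mult_right Suc.IH) auto
  thus ?case by (simp add: pochhammer_Suc algebra_simps)
qed

text \<open>
  On a line with \<open>c0 \<noteq> 0\<close> the variable is bounded away from \<open>0\<close>, so the weight \<open>s\<^sup>n\<close> controls all
  lower powers. If \<open>c0 = 0\<close>, then \<open>c0 < 1 - n\<close> forces \<open>n = 0\<close>.
\<close>

lemma inverse_Mellin_space_representation:
  assumes "f \<in> inverse_Mellin_space 0 (real n) c0" and "c0 < 1 - real n"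
  obtains h where "\<And>k. k \<le> n \<Longrightarrow> integrable lborel (\<lambda>t. pochhammer (Complex c0 t) k * h t)"
    and "\<And>x. x > 0 \<Longrightarrow> f x = mellin_inversion_deriv c0 h 0 x"
proof -
  obtain fs where fs: "integrable lborel
      (\<lambda>t. Complex c0 t powr of_nat n * fs (Complex c0 t))"
    and f: "\<And>x. x > 0 \<Longrightarrow> f x = 1 / (2 * of_real pi * \<i>) *
           line_integral c0 (\<lambda>s. fs s * of_real x powr (- s))"
    using assms(1) unfolding inverse_Mellin_space_def L1_line_def by auto
  define h where "h t = fs (Complex c0 t) / (2 * of_real pi)" for t
  have int: "integrable lborel (\<lambda>t. Complex c0 t ^ j * h t)" if "j \<le> n" for j
  proof (cases "c0 = 0")
    case False
    have "Complex c0 t powr of_nat n = Complex c0 t ^ n" for t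
      using False by (subst powr_nat) (auto simp: complex_eq_iff)
    hence "integrable lborel (\<lambda>t. Complex c0 t ^ n * h t)"
      using integrable_divide[OF fs, of "2 * of_real pi"] by (simp add: h_def)
    thus ?thesis using power_mult_integrable_on_vertical_line False that by blast
  next
    case True
    hence [simp]: "n = 0" "j = 0" using assms(2) that by auto
    \<comment> \<open>The weight \<open>s powr 0\<close> is \<open>1\<close> except at \<open>s = 0\<close>, where it is \<open>0\<close>; one point is negligible.\<close>
    have "integrable lborel (\<lambda>t. Complex c0 t powr of_nat n * fs (Complex c0 t) / (2 * of_real pi))"
      using fs by (rule integrable_divide)
    also have "?this \<longleftrightarrow> integrable lborel h"
      by (rule integrable_discrete_difference[where X = "{0}"]) (auto simp: h_def complex_eq_iff)
    finally show ?thesis by simp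
  qed
  show ?thesis
  proof (rule that)
    show "integrable lborel (\<lambda>t. pochhammer (Complex c0 t) k * h t)" if "k \<le> n" for k
      using power_pochhammer_integrable[where j = 0 and k = k, OF int] that by simp
    show "f x = mellin_inversion_deriv c0 h 0 x" if "x > 0" for x
      using f[OF that] by (simp add: line_integral_def mellin_inversion_deriv_def h_def field_simps)
  qed
qed

section \<open>The transformation in terms of the kernel\<close>

lemma rho_eq_set_integral:
  "rho z x = (LBINT t:{0<..}. of_real (exp (- t - x / t)) * of_real t powr (z - 1))"
  unfolding rho_def set_lebesgue_integral_def bessel_kernel_def
  by (intro Bochner_Integration.integral_cong refl)
    (auto simp: indicator_def powr_def exp_add exp_of_real[symmetric] Ln_of_real)

lemma F_integrand_eq_rho:
  assumes "x > 0"
  shows "F_integrand f z x = rho z x * f x / 2"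
proof -
  have "of_real x powr (z / 2) * of_real x powr (- z / 2) = (1 :: complex)"
    using assms by (simp add: powr_add[symmetric])
  thus ?thesis
    by (simp add: F_integrand_def bessel_K_two_sqrt[OF assms] rho_eq_set_integral[symmetric])
qed

lemma set_integrable_F_integrand_iff:
  assumes "S \<subseteq> {0<..}" "\<And>x. x > 0 \<Longrightarrow> f x = g x"
  shows "set_integrable lborel S (F_integrand f z) \<longleftrightarrow>
    set_integrable lborel S (\<lambda>x. rho z x * g x)"
proof -
  have "set_integrable lborel S (F_integrand f z) \<longleftrightarrow>
      set_integrable lborel S (\<lambda>x. rho z x * g x / 2)"
    using assms by (intro set_integrable_cong refl) (auto simp: F_integrand_eq_rho)
  thus ?thesis by simp
qed

lemma set_integral_F_integrand:
  assumes "S \<subseteq> {0<..}" "S \<in> sets borel" "\<And>x. x > 0 \<Longrightarrow> f x = g x"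
  shows "2 * (LBINT x:S. F_integrand f z x) = (LBINT x:S. rho z x * g x)"
proof -
  have "(LBINT x:S. F_integrand f z x) = (LBINT x:S. rho z x * g x / 2)"
    using assms by (intro set_lebesgue_integral_cong) (auto simp: F_integrand_eq_rho)
  thus ?thesis by (simp add: mult.commute)
qed

lemma atLeast_eq_greaterThan_integral:
  fixes f :: "real \<Rightarrow> complex"
  shows "(LBINT x:{y..}. f x) = (LBINT x:{y<..}. f x)"
  unfolding set_lebesgue_integral_def
  by (rule integral_discrete_difference[where X = "{y}"]) (auto simp: indicator_def)

section \<open>Derivatives and the transformation\<close>

theorem theorem2:
  fixes n :: nat and c0 :: real and f :: "real \<Rightarrow> complex"
  assumes "f \<in> inverse_Mellin_space 0 (real n) c0"
    and "c0 < 1 - real n"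
  shows "n_times_cont_differentiable_on n f {0<..} \<and>
    (\<forall>z. Re z > c0 + real n - 1 \<longrightarrow>
       set_integrable lborel {0<..} (F_integrand (nth_vderiv n f) z) \<and>
       set_integrable lborel {0<..} (F_integrand f (z - of_nat n))) \<and>
    F_transform (nth_vderiv n f) analytic_on {z. Re z > c0 + real n - 1} \<and>
    (\<forall>z. Re z > c0 + real n - 1 \<longrightarrow>
       F_transform (nth_vderiv n f) z = F_transform f (z - of_nat n)) \<and>
    (\<forall>y>0. \<forall>z.
       set_integrable lborel {y..} (F_integrand f z) \<and>
       set_integrable lborel {y..} (F_integrand (nth_vderiv n f) (z + of_nat n)) \<and>
       F_truncated y f z =
         2 * (\<Sum>m<n. of_real y powr ((z + of_nat m + 1) / 2)
                * bessel_K (z + of_nat m + 1) (2 * sqrt y) * nth_vderiv m f y)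
         + F_truncated y (nth_vderiv n f) (z + of_nat n))"
proof -
  obtain h where h: "\<And>k. k \<le> n \<Longrightarrow> integrable lborel (\<lambda>t. pochhammer (Complex c0 t) k * h t)"
    and f_eq: "\<And>x. x > 0 \<Longrightarrow> f x = mellin_inversion_deriv c0 h 0 x"
    using inverse_Mellin_space_representation[OF assms] by blast
  define g where "g = mellin_inversion_deriv c0 h"
  define C where "C k = (LBINT t. norm (pochhammer (Complex c0 t) k * h t))" for k
  have g_bound: "norm (g k x) \<le> C k * x powr (- (c0 + real k))" if "x > 0" for k x
    unfolding g_def C_def by (rule norm_mellin_inversion_deriv_le[OF that])
  have g_deriv: "(g k has_vector_derivative g (Suc k) x) (at x)" if "k < n" "x > 0" for k x
    unfolding g_def using that by (intro mellin_inversion_deriv_has_vector_derivative h) auto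
  have g_cont: "continuous_on {0<..} (g k)" if "k \<le> n" for k
    unfolding g_def using that
    by (intro continuous_at_imp_continuous_on ballI isCont_mellin_inversion_deriv h) auto
  have f_deriv: "nth_vderiv k f x = g k x" if "k \<le> n" "x > 0" for k x
    using that
  proof (induction k arbitrary: x)
    case 0
    thus ?case by (simp add: nth_vderiv_def f_eq g_def)
  next
    case (Suc k)
    have "(nth_vderiv k f has_vector_derivative g (Suc k) x) (at x)"
      by (rule has_vector_derivative_transform_within_open[OF g_deriv, of _ _ "{0<..}"])
        (use Suc in auto)
    thus ?case by (simp add: nth_vderiv_def vector_derivative_at)
  qed
  have f_has_deriv: "(nth_vderiv k f has_vector_derivative g (Suc k) x) (at x)"
    if "k < n" "x > 0" for k x
    by (rule has_vector_derivative_transform_within_open[OF g_deriv, of _ _ "{0<..}"])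
      (use that f_deriv in auto)
  have "continuous_on {0<..} (nth_vderiv n f)"
    using g_cont[of n] f_deriv[of n] by (subst continuous_on_cong[OF refl]) auto
  hence smooth: "n_times_cont_differentiable_on n f {0<..}"
    using f_has_deriv unfolding n_times_cont_differentiable_on_def
    by (auto intro: differentiableI_vector)
  have int_0: "set_integrable lborel {0<..} (\<lambda>x. rho z x * g k x)"
    if "k \<le> n" "Re z > c0 + real k - 1" for k z
    using that assms(2) by (intro rho_mult_integrable[OF g_cont g_bound]) auto
  have int_y: "set_integrable lborel {y..} (\<lambda>x. rho z x * g k x)" if "k \<le> n" "y > 0" for k y z
    using that by (intro rho_mult_integrable_at_infinity[OF g_cont g_bound]) auto
  \<comment> \<open>Each derivative raises the order by \<open>1\<close>; the boundary terms at \<open>0\<close> vanish because \<open>c0 + k < 0\<close>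
    for \<open>k < n\<close>.\<close>
  have step_0: "(LBINT x:{0<..}. rho (z - of_nat n + of_nat k) x * g k x) =
      (LBINT x:{0<..}. rho (z - of_nat n) x * g 0 x)"
    if "k \<le> n" and z: "Re z > c0 + real n - 1" for k z
    using \<open>k \<le> n\<close>
  proof (induction k)
    case (Suc k)
    define w where "w = z - of_nat n + of_nat k"
    have w: "Re w > c0 + real k - 1" using z by (simp add: w_def)
    have k: "c0 + real k < 0" using Suc.prems assms(2) by simp
    have "(LBINT x:{0<..}. rho w x * g k x) = 0 + (LBINT x:{0<..}. rho (w + 1) x * g (Suc k) x)"
    proof (rule rho_integration_by_parts[OF g_deriv g_cont g_bound])
      show "((\<lambda>x. rho (w + 1) x * g k x) \<longlongrightarrow> 0) (at_right 0)"
        by (rule rho_tendsto_0_at_right[OF g_bound k]) (use w in auto)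
      show "set_integrable lborel {0<..} (\<lambda>x. rho w x * g k x)"
        using Suc.prems w by (intro int_0) auto
      show "set_integrable lborel {0<..} (\<lambda>x. rho (w + 1) x * g (Suc k) x)"
        using Suc.prems w by (intro int_0) auto
    qed (use Suc.prems in auto)
    thus ?case using Suc by (simp add: w_def add_ac)
  qed simp
  have F_n: "F_transform (nth_vderiv n f) z = (LBINT x:{0<..}. rho z x * g n x)" for z
    unfolding F_transform_def by (intro set_integral_F_integrand) (auto simp: f_deriv)
  have F_0: "F_transform f z = (LBINT x:{0<..}. rho z x * g 0 x)" for z
    unfolding F_transform_def by (intro set_integral_F_integrand) (auto simp: f_eq g_def)
  have "(\<lambda>z. LBINT x:{0<..}. rho z x * g n x) holomorphic_on {z. Re z > c0 + real n - 1}"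
    by (rule rho_transform_holomorphic[OF g_cont g_bound]) (use assms(2) in auto)
  hence analytic: "F_transform (nth_vderiv n f) analytic_on {z. Re z > c0 + real n - 1}"
    by (subst analytic_on_open) (auto simp: F_n[abs_def] open_halfspace_Re_gt)
  have step_y: "(LBINT x:{y..}. rho z x * g 0 x) =
      (\<Sum>m<k. rho (z + of_nat m + 1) y * g m y) + (LBINT x:{y..}. rho (z + of_nat k) x * g k x)"
    if "k \<le> n" "y > 0" for k y z
    using \<open>k \<le> n\<close>
  proof (induction k)
    case (Suc k)
    define w where "w = z + of_nat k"
    have int: "set_integrable lborel {y<..} (\<lambda>x. rho v x * g j x)" if "j \<le> n" for j v
      using int_y[OF that \<open>y > 0\<close>] by (rule set_integrable_subset) auto
    have "(LBINT x:{y<..}. rho w x * g k x) = rho (w + 1) y * g k y +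
        (LBINT x:{y<..}. rho (w + 1) x * g (Suc k) x)"
    proof (rule rho_integration_by_parts[OF g_deriv g_cont g_bound])
      have "isCont (rho (w + 1)) y" "isCont (g k) y"
        using has_vector_derivative_continuous[OF rho_has_vector_derivative[OF \<open>y > 0\<close>]]
          has_vector_derivative_continuous[OF g_deriv] Suc.prems \<open>y > 0\<close> by auto
      hence "isCont (\<lambda>x. rho (w + 1) x * g k x) y" by (intro continuous_intros)
      thus "((\<lambda>x. rho (w + 1) x * g k x) \<longlongrightarrow> rho (w + 1) y * g k y) (at_right y)"
        unfolding isCont_def by (rule filterlim_mono) (auto simp: at_le)
    qed (use Suc.prems \<open>y > 0\<close> int in auto)
    thus ?case using Suc by (simp add: w_def atLeast_eq_greaterThan_integral add_ac)
  qed simp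
  have boundary: "2 * (\<Sum>m<n. of_real y powr ((z + of_nat m + 1) / 2)
        * bessel_K (z + of_nat m + 1) (2 * sqrt y) * nth_vderiv m f y) =
      (\<Sum>m<n. rho (z + of_nat m + 1) y * g m y)" if "y > 0" for y z
  proof -
    have "2 * F_integrand (nth_vderiv m f) (z + of_nat m + 1) y = rho (z + of_nat m + 1) y * g m y"
      if "m < n" for m
      using that \<open>y > 0\<close> by (simp add: F_integrand_eq_rho f_deriv)
    thus ?thesis unfolding sum_distrib_left F_integrand_def by (intro sum.cong) auto
  qed
  have trunc: "F_truncated y f z =
         2 * (\<Sum>m<n. of_real y powr ((z + of_nat m + 1) / 2)
                * bessel_K (z + of_nat m + 1) (2 * sqrt y) * nth_vderiv m f y)
         + F_truncated y (nth_vderiv n f) (z + of_nat n)" if y: "y > 0" for y z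
  proof -
    have "F_truncated y f z = (LBINT x:{y..}. rho z x * g 0 x)"
      unfolding F_truncated_def using y by (intro set_integral_F_integrand) (auto simp: f_eq g_def)
    moreover have "F_truncated y (nth_vderiv n f) (z + of_nat n) =
        (LBINT x:{y..}. rho (z + of_nat n) x * g n x)"
      unfolding F_truncated_def using y by (intro set_integral_F_integrand) (auto simp: f_deriv)
    ultimately show ?thesis
      unfolding boundary[OF y] by (simp only: step_y[OF order_refl y])
  qed
  have f_g0: "\<And>x. x > 0 \<Longrightarrow> f x = g 0 x" by (simp add: f_eq g_def)
  have int_iff: "set_integrable lborel S (F_integrand f z) \<longleftrightarrow> set_integrable lborel S (\<lambda>x. rho z x * g 0 x)"
    "set_integrable lborel S (F_integrand (nth_vderiv n f) z) \<longleftrightarrow>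
      set_integrable lborel S (\<lambda>x. rho z x * g n x)" if "S \<subseteq> {0<..}" for S z
    using that by (intro set_integrable_F_integrand_iff f_deriv f_g0; simp)+
  show ?thesis
  proof (intro conjI allI impI)
    fix z assume z: "Re z > c0 + real n - 1"
    show "set_integrable lborel {0<..} (F_integrand (nth_vderiv n f) z)"
      using int_0[of n z] z by (simp add: int_iff)
    show "set_integrable lborel {0<..} (F_integrand f (z - of_nat n))"
      using int_0[of 0 "z - of_nat n"] z by (simp add: int_iff)
    show "F_transform (nth_vderiv n f) z = F_transform f (z - of_nat n)"
      using step_0[OF order_refl z] by (simp add: F_n F_0)
  next
    fix y :: real and z assume y: "y > 0"
    show "set_integrable lborel {y..} (F_integrand f z)"
      using int_y[of 0 y z] y by (subst int_iff) auto
    show "set_integrable lborel {y..} (F_integrand (nth_vderiv n f) (z + of_nat n))"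
      using int_y[of n y "z + of_nat n"] y by (subst int_iff) auto
  qed (fact smooth analytic trunc)+
qed

end
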